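(* Let $\alpha,\beta,\gamma$ be nonzero real numbers satisfying $$0\le\alpha\le\beta+\gamma,\qquad 0\le\gamma\le\alpha+\beta.$$ Define the sequence $a(m)$, $m\ge 3$, by $$a(3)=\alpha^3+\beta^3+\gamma^3+3\alpha\beta\gamma,\qquad a(4)=\alpha^4+\beta^4+\gamma^4+4\alpha\beta^2\gamma+2(\alpha\gamma)^2,$$ $$a(m)=\beta a(m-1)+\alpha\gamma a(m-2)+\alpha^{m-1}(\alpha-\beta-\gamma)+\gamma^{m-1}(\gamma-\beta-\alpha),\quad m\ge 5,$$ and suppose in addition that $$a(4)^3\le a(3)^4,\qquad \alpha\gamma+\beta\,(a(3))^{1/3}\le (a(3))^{2/3}.$$ Then for every positive integer $n$ divisible by $3$, the maximal value $M_n(\alpha,\beta,\gamma)$ of the permanent on $\widehat{\Lambda}_n(\alpha,\beta,\gamma)$ is $$M_n(\alpha,\beta,\gamma)=(a(3))^{n/3}.$$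
   Context: $\Lambda_n(\alpha,\beta,\gamma)$ is the class of $n\times n$ matrices containing each of $\alpha,\beta,\gamma$ exactly once in each row and in each column, all other entries being $0$ (i.e. matrices $\alpha A+\beta B+\gamma C$ with $A,B,C$ permutation matrices with pairwise disjoint supports). $\widehat{\Lambda}_n(\alpha,\beta,\gamma)$ is the subclass of those matrices with $\beta$'s on the main diagonal and with symmetric positions of $\alpha$ and $\gamma$ ($\alpha$ is placed at $(i,j)$ if and only if $\gamma$ is placed at $(j,i)$); equivalently, the set of matrices $\alpha S^{-1}+\beta I_n+\gamma S$, where $S$ is the permutation matrix of a permutation of $\{1,\dots,n\}$ all of whose cycles have length at least $3$. $M_n(\alpha,\beta,\gamma)$ denotes the maximum of the permanent over $\widehat{\Lambda}_n(\alpha,\beta,\gamma)$. *)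

theory Defs
  imports Complex_Main "HOL-Combinatorics.Orbits" "Jordan_Normal_Form.Matrix"
begin

text \<open>Same conventions as for \<open>det\<close>: rows and columns are indexed from 0, and a non-square
  matrix gets the value 0.\<close>

definition permanent :: "'a mat \<Rightarrow> 'a :: comm_semiring_1" where
  "permanent A =
     (if dim_row A = dim_col A
      then \<Sum>p | p permutes {0..<dim_row A}. \<Prod>i = 0..<dim_row A. A $$ (i, p i)
      else 0)"

definition perm_mat :: "nat \<Rightarrow> (nat \<Rightarrow> nat) \<Rightarrow> real mat" where
  "perm_mat n p = mat n n (\<lambda>(i, j). if j = p i then 1 else 0)"

definition permutation_matrix :: "nat \<Rightarrow> real mat \<Rightarrow> bool" where
  "permutation_matrix n A \<longleftrightarrow> (\<exists>p. p permutes {0..<n} \<and> A = perm_mat n p)"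

definition disjoint_supports :: "nat \<Rightarrow> real mat \<Rightarrow> real mat \<Rightarrow> bool" where
  "disjoint_supports n A B \<longleftrightarrow> (\<forall>i<n. \<forall>j<n. A $$ (i, j) = 0 \<or> B $$ (i, j) = 0)"

text \<open>The three values need not be distinct, so the positions of \<open>\<alpha>\<close>, \<open>\<beta>\<close>, \<open>\<gamma>\<close> in a matrix
  \<open>\<alpha> A + \<beta> B + \<gamma> C\<close> are understood as the supports of \<open>A\<close>, \<open>B\<close>, \<open>C\<close>; they cannot be read off
  from the entries of the matrix.\<close>

definition placement :: "nat \<Rightarrow> real mat \<Rightarrow> real mat \<Rightarrow> real mat \<Rightarrow> bool" where
  "placement n A B C \<longleftrightarrow>
     permutation_matrix n A \<and> permutation_matrix n B \<and> permutation_matrix n C \<and>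
     disjoint_supports n A B \<and> disjoint_supports n A C \<and> disjoint_supports n B C"

definition Lambda :: "nat \<Rightarrow> real \<Rightarrow> real \<Rightarrow> real \<Rightarrow> real mat set" where
  "Lambda n \<alpha> \<beta> \<gamma> = {\<alpha> \<cdot>\<^sub>m A + \<beta> \<cdot>\<^sub>m B + \<gamma> \<cdot>\<^sub>m C | A B C. placement n A B C}"

definition Lambda_hat :: "nat \<Rightarrow> real \<Rightarrow> real \<Rightarrow> real \<Rightarrow> real mat set" where
  "Lambda_hat n \<alpha> \<beta> \<gamma> =
     {\<alpha> \<cdot>\<^sub>m A + \<beta> \<cdot>\<^sub>m B + \<gamma> \<cdot>\<^sub>m C | A B C. placement n A B C \<and>
        (\<forall>i<n. B $$ (i, i) = 1) \<and>
        (\<forall>i<n. \<forall>j<n. A $$ (i, j) = 1 \<longleftrightarrow> C $$ (j, i) = 1)}"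

lemma Lambda_hat_subset: "Lambda_hat n \<alpha> \<beta> \<gamma> \<subseteq> Lambda n \<alpha> \<beta> \<gamma>"
  unfolding Lambda_hat_def Lambda_def by blast

lemma finite_Lambda: "finite (Lambda n \<alpha> \<beta> \<gamma>)"
proof -
  let ?P = "perm_mat n ` {p. p permutes {0..<n}}"
  have "finite ?P" by (simp add: finite_permutations)
  moreover have "Lambda n \<alpha> \<beta> \<gamma> \<subseteq> (\<lambda>(A, B, C). \<alpha> \<cdot>\<^sub>m A + \<beta> \<cdot>\<^sub>m B + \<gamma> \<cdot>\<^sub>m C) ` (?P \<times> ?P \<times> ?P)"
    unfolding Lambda_def placement_def permutation_matrix_def by force
  ultimately show ?thesis by (meson finite_SigmaI finite_imageI finite_subset)
qed

lemma finite_Lambda_hat: "finite (Lambda_hat n \<alpha> \<beta> \<gamma>)"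
  using Lambda_hat_subset finite_Lambda by (rule finite_subset)

lemma card_orbit_ge_3_iff:
  fixes p :: "nat \<Rightarrow> nat"
  assumes "p permutes {0..<n}" "i < n"
  shows "3 \<le> card (orbit p i) \<longleftrightarrow> p i \<noteq> i \<and> p (p i) \<noteq> i"
proof -
  have perm: "permutation p" using assms(1) by (intro permutes_imp_permutation) auto
  have fin: "finite (orbit p i)"
    using perm by (intro finite_orbit permutation_self_in_orbit)
  have self: "i \<in> orbit p i" using perm by (rule permutation_self_in_orbit)
  have inj: "inj p" using assms(1) by (rule permutes_inj)
  show ?thesis
  proof
    assume *: "3 \<le> card (orbit p i)"
    have "False" if "p i = i \<or> p (p i) = i"
    proof -
      have "x \<in> {i, p i}" if "x \<in> orbit p i" for x
        using that \<open>p i = i \<or> p (p i) = i\<close> by induction auto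
      then have "card (orbit p i) \<le> card {i, p i}" by (intro card_mono) auto
      also have "\<dots> \<le> 2" by (simp add: card_insert_if)
      finally show False using * by simp
    qed
    then show "p i \<noteq> i \<and> p (p i) \<noteq> i" by blast
  next
    assume *: "p i \<noteq> i \<and> p (p i) \<noteq> i"
    then have "p (p i) \<noteq> p i" using inj by (simp add: inj_eq)
    then have "card {i, p i, p (p i)} = 3" using * by (auto simp: card_insert_if)
    moreover have "{i, p i, p (p i)} \<subseteq> orbit p i"
      using self by (auto intro: orbit.intros)
    ultimately show "3 \<le> card (orbit p i)" using fin card_mono by metis
  qed
qed

lemma perm_mat_id: "perm_mat n id = 1\<^sub>m n"
  unfolding perm_mat_def by (intro eq_matI) auto

lemma perm_mat_index [simp]:
  "i < n \<Longrightarrow> j < n \<Longrightarrow> perm_mat n p $$ (i, j) = (if j = p i then 1 else 0)"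
  by (simp add: perm_mat_def)

theorem Lambda_hat_eq:
  "Lambda_hat n \<alpha> \<beta> \<gamma> =
     {\<alpha> \<cdot>\<^sub>m perm_mat n (inv_into UNIV p) + \<beta> \<cdot>\<^sub>m 1\<^sub>m n + \<gamma> \<cdot>\<^sub>m perm_mat n p | p.
        p permutes {0..<n} \<and> (\<forall>i<n. 3 \<le> card (orbit p i))}" (is "?L = ?R")
proof (intro equalityI subsetI)
  fix X assume "X \<in> ?L"
  then obtain A B C where X: "X = \<alpha> \<cdot>\<^sub>m A + \<beta> \<cdot>\<^sub>m B + \<gamma> \<cdot>\<^sub>m C"
    and pl: "placement n A B C" and diag: "\<forall>i<n. B $$ (i, i) = 1"
    and sym: "\<forall>i<n. \<forall>j<n. A $$ (i, j) = 1 \<longleftrightarrow> C $$ (j, i) = 1"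
    unfolding Lambda_hat_def by blast
  from pl obtain q r p where q: "q permutes {0..<n}" "A = perm_mat n q"
    and r: "r permutes {0..<n}" "B = perm_mat n r"
    and p: "p permutes {0..<n}" "C = perm_mat n p"
    unfolding placement_def permutation_matrix_def by blast
  have lt: "q i < n" "r i < n" "p i < n" if "i < n" for i
    using that permutes_in_image[OF q(1)] permutes_in_image[OF r(1)] permutes_in_image[OF p(1)]
    by auto
  have ri: "r i = i" if "i < n" for i
    using diag[rule_format, OF that] that by (simp add: r(2) split: if_splits)
  have B: "B = 1\<^sub>m n"
    unfolding r(2) perm_mat_id[symmetric]
    by (intro eq_matI) (simp_all add: perm_mat_def ri)
  have qp: "q (p i) = i" if "i < n" for i
    using sym[rule_format, of "p i" i] that lt[OF that] by (auto simp: q(2) p(2) split: if_splits)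
  have q_inv: "q = inv_into UNIV p"
  proof
    fix i
    have "q (p x) = x" for x
    proof (cases "x < n")
      case False
      then show ?thesis using p(1) q(1) by (simp add: permutes_def)
    qed (rule qp)
    from this[of "inv_into UNIV p i"] show "q i = inv_into UNIV p i"
      using p(1) by (simp add: permutes_inverses)
  qed
  have dBC: "disjoint_supports n B C" and dAC: "disjoint_supports n A C"
    using pl by (auto simp: placement_def)
  have "3 \<le> card (orbit p i)" if i: "i < n" for i
  proof -
    have "p i \<noteq> i"
      using dBC i unfolding disjoint_supports_def B p(2) by (auto split: if_splits)
    moreover have "p (p i) \<noteq> i"
    proof
      assume *: "p (p i) = i"
      have "A $$ (p i, i) = 1" "C $$ (p i, i) = 1"
        using i lt[OF i] qp[OF i] * by (auto simp: q(2) p(2))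
      moreover have "A $$ (p i, i) = 0 \<or> C $$ (p i, i) = 0"
        using dAC i lt(3)[OF i] unfolding disjoint_supports_def by blast
      ultimately show False by simp
    qed
    ultimately show ?thesis using card_orbit_ge_3_iff[OF p(1) i] by blast
  qed
  then show "X \<in> ?R"
    unfolding X B q(2) p(2) q_inv using p(1) by (intro CollectI exI[of _ p] conjI) auto
next
  fix X assume "X \<in> ?R"
  then obtain p where X: "X = \<alpha> \<cdot>\<^sub>m perm_mat n (inv_into UNIV p) + \<beta> \<cdot>\<^sub>m 1\<^sub>m n + \<gamma> \<cdot>\<^sub>m perm_mat n p"
    and p: "p permutes {0..<n}" and orb: "\<forall>i<n. 3 \<le> card (orbit p i)" by blast
  have ne: "p i \<noteq> i" "p (p i) \<noteq> i" if "i < n" for i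
    using orb card_orbit_ge_3_iff[OF p that] that by auto
  have inv_eq: "j = inv_into UNIV p i \<longleftrightarrow> i = p j" for i j
    using permutes_inv_eq[OF p] by metis
  have "disjoint_supports n (perm_mat n (inv_into UNIV p)) (1\<^sub>m n)"
    "disjoint_supports n (perm_mat n (inv_into UNIV p)) (perm_mat n p)"
    "disjoint_supports n (1\<^sub>m n) (perm_mat n p)"
    unfolding disjoint_supports_def using ne ne[THEN not_sym] by (auto simp: inv_eq simp flip: perm_mat_id)
  moreover have "permutation_matrix n (perm_mat n (inv_into UNIV p))"
    "permutation_matrix n (1\<^sub>m n)" "permutation_matrix n (perm_mat n p)"
    unfolding permutation_matrix_def perm_mat_id[symmetric]
    using permutes_inv[OF p] p permutes_id by blast+
  ultimately have "placement n (perm_mat n (inv_into UNIV p)) (1\<^sub>m n) (perm_mat n p)"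
    by (simp add: placement_def)
  moreover have "\<forall>i<n. \<forall>j<n. perm_mat n (inv_into UNIV p) $$ (i, j) = 1 \<longleftrightarrow> perm_mat n p $$ (j, i) = 1"
    by (auto simp: inv_eq)
  moreover have "\<forall>i<n. (1\<^sub>m n :: real mat) $$ (i, i) = 1" by simp
  ultimately show "X \<in> ?L"
    unfolding Lambda_hat_def X
    by (intro CollectI exI[of _ "perm_mat n (inv_into UNIV p)"] exI[of _ "1\<^sub>m n"]
        exI[of _ "perm_mat n p"] conjI refl)
qed

lemma Lambda_hat_nonempty:
  assumes "3 \<le> n"
  shows "Lambda_hat n \<alpha> \<beta> \<gamma> \<noteq> {}"
proof -
  define p where "p i = (if i < n then if Suc i = n then 0 else Suc i else i)" for i
  have "inj_on p {0..<n}" by (auto simp: p_def inj_on_def split: if_splits)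
  moreover have "p ` {0..<n} \<subseteq> {0..<n}" by (auto simp: p_def)
  ultimately have "bij_betw p {0..<n} {0..<n}"
    by (simp add: bij_betw_def endo_inj_surj)
  then have p: "p permutes {0..<n}" by (intro bij_imp_permutes) (auto simp: p_def)
  have "3 \<le> card (orbit p i)" if "i < n" for i
    unfolding card_orbit_ge_3_iff[OF p that] using that assms by (auto simp: p_def)
  then show ?thesis unfolding Lambda_hat_eq using p by blast
qed

text \<open>For \<open>n \<ge> 3\<close> this is the maximum of a finite nonempty set, by the lemmas above.\<close>

definition M :: "nat \<Rightarrow> real \<Rightarrow> real \<Rightarrow> real \<Rightarrow> real" where
  "M n \<alpha> \<beta> \<gamma> = Max (permanent ` Lambda_hat n \<alpha> \<beta> \<gamma>)"

end

theory Submission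
  imports Defs
begin

text \<open>The permanent of a matrix in \<open>\<Lambda>-hat\<close> factors over the cycles of the underlying permutation
  \<open>p\<close>, a cycle of length \<open>m\<close> contributing a number \<open>a(m)\<close>. Expanding along a row and a column
  through the wrap-around corners reduces \<open>a(m)\<close> to tridiagonal permanents, which gives the
  recurrence of the statement. With \<open>t = a(3)^(1/3)\<close>, the two correction terms of the recurrence
  are nonpositive, so \<open>a(m) \<le> \<beta> t^(m-1) + \<alpha>\<gamma> t^(m-2) \<le> t^m\<close> by induction, and every permanent
  is at most \<open>t^n = a(3)^(n/3)\<close>, with equality when all cycles have length 3.\<close>

section \<open>Permanents with arbitrary row and column sets\<close>

text \<open>The bijections are normalised to be the identity off \<open>R\<close>, so that for \<open>R = C\<close> they are exactly
  the permutations of \<open>R\<close> in the sense of \<open>permutes\<close>.\<close>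

definition rect_permanent :: "('a \<Rightarrow> 'a \<Rightarrow> 'b) \<Rightarrow> 'a set \<Rightarrow> 'a set \<Rightarrow> 'b :: comm_semiring_1" where
  "rect_permanent A R C =
     (\<Sum>f | bij_betw f R C \<and> (\<forall>x. x \<notin> R \<longrightarrow> f x = x). \<Prod>i\<in>R. A i (f i))"

lemma rect_permanent_empty [simp]:
  fixes A :: "'a \<Rightarrow> 'a \<Rightarrow> 'b :: comm_semiring_1"
  shows "rect_permanent A {} {} = 1"
proof -
  have "(\<forall>x. f x = x) \<longleftrightarrow> f = id" for f :: "'a \<Rightarrow> 'a"
    by auto
  then show ?thesis by (simp add: rect_permanent_def bij_betw_def)
qed

lemma rect_permanent_cong:
  assumes "\<And>i j. i \<in> R \<Longrightarrow> j \<in> C \<Longrightarrow> A i j = B i j"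
  shows "rect_permanent A R C = rect_permanent B R C"
  unfolding rect_permanent_def
  by (intro sum.cong refl prod.cong) (auto simp: bij_betw_def intro!: assms)

lemma finite_bij_betw_eq_id_off:
  assumes "finite R" "finite C"
  shows "finite {f. bij_betw f R C \<and> (\<forall>x. x \<notin> R \<longrightarrow> f x = x)}"
proof -
  have "finite (PiE R (\<lambda>_. C))" using assms by (intro finite_PiE) auto
  then have "finite ((\<lambda>g x. if x \<in> R then g x else x) ` PiE R (\<lambda>_. C))" by simp
  moreover have "{f. bij_betw f R C \<and> (\<forall>x. x \<notin> R \<longrightarrow> f x = x)}
      \<subseteq> (\<lambda>g x. if x \<in> R then g x else x) ` PiE R (\<lambda>_. C)"
  proof
    fix f assume f: "f \<in> {f. bij_betw f R C \<and> (\<forall>x. x \<notin> R \<longrightarrow> f x = x)}"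
    show "f \<in> (\<lambda>g x. if x \<in> R then g x else x) ` PiE R (\<lambda>_. C)"
      using f by (intro image_eqI[of _ _ "restrict f R"]) (auto simp: bij_betw_def)
  qed
  ultimately show ?thesis by (rule rev_finite_subset)
qed

text \<open>Laplace expansion. A bijection \<open>f\<close> is split into its value at
  \<open>r\<close> and the map \<open>f(r := r)\<close>; resetting that value to \<open>r\<close> is
  what the normalisation off \<open>R - {r}\<close> demands.\<close>

lemma rect_permanent_row:
  assumes fin: "finite R" "finite C" and r: "r \<in> R"
  shows "rect_permanent A R C = (\<Sum>c\<in>C. A r c * rect_permanent A (R - {r}) (C - {c}))"
proof -
  let ?S = "\<lambda>R C. {f. bij_betw f R C \<and> (\<forall>x. x \<notin> R \<longrightarrow> f x = x)}"
  have bij: "bij_betw (f(r := c)) R C" if "bij_betw f (R - {r}) (C - {c})" "c \<in> C" for f c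
  proof -
    have "bij_betw (f(r := c)) (R - {r}) (C - {c})"
      using that bij_betw_cong[of "R - {r}" "f(r := c)" f "C - {c}"] by simp
    then show ?thesis
      using notIn_Un_bij_betw[of r "R - {r}" "f(r := c)" "C - {c}"] that(2) r
      by (auto simp: insert_absorb)
  qed
  have bij': "bij_betw (f(r := r)) (R - {r}) (C - {f r})" if "bij_betw f R C" for f
  proof -
    have "bij_betw f (R - {r}) (C - {f r})" using that r by (auto simp: bij_betw_def inj_on_def)
    then show ?thesis using bij_betw_cong[of "R - {r}" "f(r := r)" f "C - {f r}"] by simp
  qed
  have "rect_permanent A R C = (\<Sum>f\<in>?S R C. \<Prod>i\<in>R. A i (f i))"
    by (simp add: rect_permanent_def)
  also have "\<dots> = (\<Sum>(c, f)\<in>Sigma C (\<lambda>c. ?S (R - {r}) (C - {c})). A r c * (\<Prod>i\<in>R - {r}. A i (f i)))"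
  proof (intro sum.reindex_bij_witness[of _ "\<lambda>(c, f). f(r := c)" "\<lambda>f. (f r, f(r := r))"])
    fix f assume f: "f \<in> ?S R C"
    show "(\<lambda>f. (f r, f(r := r))) f \<in> Sigma C (\<lambda>c. ?S (R - {r}) (C - {c}))"
      using f bij'[of f] r by (auto simp: bij_betw_def)
    have "(\<Prod>i\<in>R. A i (f i)) = A r (f r) * (\<Prod>i\<in>R - {r}. A i (f i))"
      using fin r by (simp add: prod.remove)
    also have "(\<Prod>i\<in>R - {r}. A i (f i)) = (\<Prod>i\<in>R - {r}. A i ((f(r := r)) i))"
      by (intro prod.cong) auto
    finally show "(case (f r, f(r := r)) of (c, f) \<Rightarrow> A r c * (\<Prod>i\<in>R - {r}. A i (f i))) = (\<Prod>i\<in>R. A i (f i))"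
      by simp
  next
    fix b assume "b \<in> Sigma C (\<lambda>c. ?S (R - {r}) (C - {c}))"
    then show "(case b of (c, f) \<Rightarrow> f(r := c)) \<in> ?S R C"
      using bij r by auto
  qed (auto simp: fun_eq_iff)
  also have "\<dots> = (\<Sum>c\<in>C. \<Sum>f\<in>?S (R - {r}) (C - {c}). A r c * (\<Prod>i\<in>R - {r}. A i (f i)))"
    using fin finite_bij_betw_eq_id_off[of "R - {r}"] by (intro sum.Sigma[symmetric]) auto
  finally show ?thesis by (simp add: rect_permanent_def sum_distrib_left)
qed

text \<open>Bijections are reindexed by their inverses, so column expansion and lower triangular
  minors come for free from the row versions.\<close>

lemma rect_permanent_transpose:
  fixes A :: "'a \<Rightarrow> 'a \<Rightarrow> 'b :: comm_semiring_1"
  shows "rect_permanent A R C = rect_permanent (\<lambda>i j. A j i) C R"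
proof -
  \<comment> \<open>The inverse of \<open>f\<close> on its image, continued by the identity so that
    the normalisation survives the exchange of \<open>R\<close> and \<open>C\<close>.\<close>
  define g where "g R f c = (if c \<in> f ` R then inv_into R f c else c)" for R :: "'a set" and f :: "'a \<Rightarrow> 'a" and c
  have bij: "bij_betw (g R f) C R" if "bij_betw f R C" for f R C
  proof -
    have "bij_betw (inv_into R f) C R" using that by (rule bij_betw_inv_into)
    moreover have "g R f c = inv_into R f c" if "c \<in> C" for c
      using that \<open>bij_betw f R C\<close> by (simp add: g_def bij_betw_def)
    ultimately show ?thesis by (simp cong: bij_betw_cong)
  qed
  have gg: "g C (g R f) = f" if f: "bij_betw f R C" "\<forall>x. x \<notin> R \<longrightarrow> f x = x" for f R C
  proof
    fix x
    show "g C (g R f) x = f x"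
    proof (cases "x \<in> R")
      case True
      have "g R f (f x) = x" using f True by (auto simp: g_def bij_betw_def)
      moreover have "f x \<in> C" using f True by (auto simp: bij_betw_def)
      moreover have "inj_on (g R f) C" using bij[OF f(1)] by (simp add: bij_betw_def)
      ultimately show ?thesis unfolding g_def[of C] by (metis image_eqI inv_into_f_f)
    next
      case False
      have "g R f ` C = R" using bij[OF f(1)] by (simp add: bij_betw_def)
      then show ?thesis using False f by (simp add: g_def[of C])
    qed
  qed
  have off: "g R f x = x" if "bij_betw f R C" "x \<notin> C" for f R C x
    using that by (auto simp: g_def bij_betw_def)
  show ?thesis
    unfolding rect_permanent_def
  proof (intro sum.reindex_bij_witness[of _ "g C" "g R"])
    fix f assume "f \<in> {f. bij_betw f R C \<and> (\<forall>x. x \<notin> R \<longrightarrow> f x = x)}"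
    then have f: "bij_betw f R C" "\<forall>x. x \<notin> R \<longrightarrow> f x = x" by auto
    show "g C (g R f) = f" using f by (rule gg)
    show "g R f \<in> {f. bij_betw f C R \<and> (\<forall>x. x \<notin> C \<longrightarrow> f x = x)}"
      using bij[OF f(1)] off[OF f(1)] by auto
    show "(\<Prod>i\<in>C. A (g R f i) i) = (\<Prod>i\<in>R. A i (f i))"
      using f by (intro prod.reindex_bij_witness[of _ f "g R f"]) (auto simp: g_def bij_betw_def)
  next
    fix f assume "f \<in> {f. bij_betw f C R \<and> (\<forall>x. x \<notin> C \<longrightarrow> f x = x)}"
    then have f: "bij_betw f C R" "\<forall>x. x \<notin> C \<longrightarrow> f x = x" by auto
    show "g R (g C f) = f" using f by (rule gg)
    show "g C f \<in> {f. bij_betw f R C \<and> (\<forall>x. x \<notin> R \<longrightarrow> f x = x)}"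
      using bij[OF f(1)] off[OF f(1)] by auto
  qed
qed

lemma rect_permanent_col:
  assumes "finite R" "finite C" "c \<in> C"
  shows "rect_permanent A R C = (\<Sum>r\<in>R. A r c * rect_permanent A (R - {r}) (C - {c}))"
  unfolding rect_permanent_transpose[of A R C] rect_permanent_row[OF assms(2,1,3)]
  by (simp add: rect_permanent_transpose[of _ "C - {c}"])

text \<open>Relabelling of indices. Induction by row expansion avoids conjugating normalised
  bijections by \<open>h\<close>, which is injective only on \<open>R \<union> C\<close>.\<close>

lemma rect_permanent_image:
  assumes "finite R" "finite C" "inj_on h (R \<union> C)"
  shows "rect_permanent A (h ` R) (h ` C) = rect_permanent (\<lambda>i j. A (h i) (h j)) R C"
  using assms
proof (induction R arbitrary: C rule: finite_induct)
  case empty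
  \<comment> \<open>For nonempty \<open>C\<close> there is no bijection from the empty set, so both
    sides are empty sums.\<close>
  then show ?case by (cases "C = {}") (simp, simp add: rect_permanent_def bij_betw_def)
next
  case (insert r R)
  have diff: "h ` insert r R - {h r} = h ` R"
    using insert.hyps insert.prems by (auto simp: inj_on_def)
  have diff': "h ` C - {h c} = h ` (C - {c})" if "c \<in> C" for c
    using that insert.prems by (auto simp: inj_on_def)
  have "rect_permanent A (h ` insert r R) (h ` C)
      = (\<Sum>c\<in>h ` C. A (h r) c * rect_permanent A (h ` insert r R - {h r}) (h ` C - {c}))"
    using insert by (intro rect_permanent_row) auto
  also have "\<dots> = (\<Sum>c\<in>C. A (h r) (h c) * rect_permanent A (h ` R) (h ` C - {h c}))"
    unfolding diff using insert.prems by (subst sum.reindex) (auto simp: inj_on_def)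
  also have "\<dots> = (\<Sum>c\<in>C. A (h r) (h c) * rect_permanent (\<lambda>i j. A (h i) (h j)) R (C - {c}))"
  proof (intro sum.cong refl)
    fix c assume c: "c \<in> C"
    have "rect_permanent A (h ` R) (h ` (C - {c})) = rect_permanent (\<lambda>i j. A (h i) (h j)) R (C - {c})"
      using insert.prems by (intro insert.IH) (auto intro: inj_on_subset)
    then show "A (h r) (h c) * rect_permanent A (h ` R) (h ` C - {h c}) = A (h r) (h c) * rect_permanent (\<lambda>i j. A (h i) (h j)) R (C - {c})"
      using diff'[OF c] by simp
  qed
  also have "\<dots> = rect_permanent (\<lambda>i j. A (h i) (h j)) (insert r R) C"
    using insert by (subst rect_permanent_row[of "insert r R" C r]) auto
  finally show ?case .
qed

text \<open>Rows of \<open>R\<close> vanish on \<open>C'\<close>, so expanding along them one by one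
  consumes columns of \<open>C\<close> only. As \<open>card R = card C\<close>, exactly
  \<open>C'\<close> is left for \<open>R'\<close>.\<close>

lemma rect_permanent_block_triangular:
  assumes "finite R" "finite C" "finite R'" "finite C'" "R \<inter> R' = {}" "C \<inter> C' = {}"
    and "card R = card C"
    and "\<And>i j. i \<in> R \<Longrightarrow> j \<in> C' \<Longrightarrow> A i j = 0"
  shows "rect_permanent A (R \<union> R') (C \<union> C') = rect_permanent A R C * rect_permanent A R' C'"
  using assms
proof (induction R arbitrary: C rule: finite_induct)
  case empty
  then show ?case by simp
next
  case (insert r R)
  have "rect_permanent A (insert r R \<union> R') (C \<union> C')
      = (\<Sum>c\<in>C \<union> C'. A r c * rect_permanent A (insert r R \<union> R' - {r}) (C \<union> C' - {c}))"
    using insert.prems insert.hyps by (intro rect_permanent_row) auto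
  also have "\<dots> = (\<Sum>c\<in>C. A r c * rect_permanent A (insert r R \<union> R' - {r}) (C \<union> C' - {c}))"
    using insert.prems insert.hyps by (intro sum.mono_neutral_right) auto
  also have "\<dots> = (\<Sum>c\<in>C. A r c * rect_permanent A R (C - {c})) * rect_permanent A R' C'"
    unfolding sum_distrib_right
  proof (intro sum.cong refl)
    fix c assume c: "c \<in> C"
    have "insert r R \<union> R' - {r} = R \<union> R'" "C \<union> C' - {c} = (C - {c}) \<union> C'"
      using insert.prems insert.hyps c by auto
    moreover have "rect_permanent A (R \<union> R') ((C - {c}) \<union> C')
        = rect_permanent A R (C - {c}) * rect_permanent A R' C'"
      using insert.prems insert.hyps c by (intro insert.IH) (auto simp: card_Diff_singleton)
    ultimately show "A r c * rect_permanent A (insert r R \<union> R' - {r}) (C \<union> C' - {c})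
        = A r c * rect_permanent A R (C - {c}) * rect_permanent A R' C'"
      by (simp add: mult.assoc)
  qed
  also have "(\<Sum>c\<in>C. A r c * rect_permanent A R (C - {c})) = rect_permanent A (insert r R) C"
    using insert.prems insert.hyps by (subst rect_permanent_row[of "insert r R" C r]) auto
  finally show ?case .
qed

lemma rect_permanent_block_diagonal:
  assumes "finite P" "\<And>B. B \<in> P \<Longrightarrow> finite B" "disjoint P"
    and "\<And>B B' i j. B \<in> P \<Longrightarrow> B' \<in> P \<Longrightarrow> B \<noteq> B' \<Longrightarrow> i \<in> B \<Longrightarrow> j \<in> B' \<Longrightarrow> A i j = 0"
  shows "rect_permanent A (\<Union>P) (\<Union>P) = (\<Prod>B\<in>P. rect_permanent A B B)"
  using assms
proof (induction P rule: finite_induct)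
  case empty
  then show ?case by simp
next
  case (insert B P)
  have "B \<inter> \<Union>P = {}"
    using insert.prems(2) insert.hyps by (fastforce simp: disjoint_def)
  then have "rect_permanent A (B \<union> \<Union>P) (B \<union> \<Union>P) = rect_permanent A B B * rect_permanent A (\<Union>P) (\<Union>P)"
    using insert.prems(1) insert.hyps insert.prems(3)
    by (intro rect_permanent_block_triangular) (auto, metis)
  moreover have "rect_permanent A (\<Union>P) (\<Union>P) = (\<Prod>B\<in>P. rect_permanent A B B)"
  proof (intro insert.IH)
    fix B1 B2 i j assume "B1 \<in> P" "B2 \<in> P" "B1 \<noteq> B2" "i \<in> B1" "j \<in> B2"
    then show "A i j = 0" using insert.prems(3)[of B1 B2] by auto
  qed (use insert.prems in \<open>auto simp: disjoint_def\<close>)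
  ultimately show ?case using insert.hyps by simp
qed

section \<open>The permanent of a single cycle\<close>

text \<open>A single band matrix on all naturals: the finite tridiagonal matrices are its windows,
  and removing a first row and column merely shifts the window.\<close>

definition tridiag :: "real \<Rightarrow> real \<Rightarrow> real \<Rightarrow> nat \<Rightarrow> nat \<Rightarrow> real" where
  "tridiag \<alpha> \<beta> \<gamma> i j = (if j = i then \<beta> else if j = Suc i then \<gamma> else if i = Suc j then \<alpha> else 0)"

lemma tridiag_simps [simp]:
  "tridiag \<alpha> \<beta> \<gamma> i i = \<beta>" "tridiag \<alpha> \<beta> \<gamma> i (Suc i) = \<gamma>" "tridiag \<alpha> \<beta> \<gamma> (Suc i) i = \<alpha>"
  by (simp_all add: tridiag_def)

text \<open>Euler's continuant recurrence with constant coefficients; the sign is plus because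
  permanents carry no signs. \<open>\<delta>\<close> stands for the product of the two off-diagonal
  values.\<close>

fun continuant :: "real \<Rightarrow> real \<Rightarrow> nat \<Rightarrow> real" where
  "continuant \<beta> \<delta> 0 = 1"
| "continuant \<beta> \<delta> (Suc 0) = \<beta>"
| "continuant \<beta> \<delta> (Suc (Suc k)) = \<beta> * continuant \<beta> \<delta> (Suc k) + \<delta> * continuant \<beta> \<delta> k"

lemma rect_permanent_row_support:
  assumes "finite R" "finite C" "r \<in> R" "S \<subseteq> C" "\<And>c. c \<in> C - S \<Longrightarrow> A r c = 0"
  shows "rect_permanent A R C = (\<Sum>c\<in>S. A r c * rect_permanent A (R - {r}) (C - {c}))"
  unfolding rect_permanent_row[OF assms(1-3)]
  using assms by (intro sum.mono_neutral_right) auto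

lemma rect_permanent_col_support:
  assumes "finite R" "finite C" "c \<in> C" "S \<subseteq> R" "\<And>r. r \<in> R - S \<Longrightarrow> A r c = 0"
  shows "rect_permanent A R C = (\<Sum>r\<in>S. A r c * rect_permanent A (R - {r}) (C - {c}))"
  unfolding rect_permanent_col[OF assms(1-3)]
  using assms by (intro sum.mono_neutral_right) auto

text \<open>Row \<open>i\<close> meets columns \<open>i\<close> and \<open>Suc i\<close>. In the
  minor for \<open>Suc i\<close>, column \<open>i\<close> keeps only the entry
  \<open>\<alpha>\<close> in row \<open>Suc i\<close>, and expanding along it leaves a window of
  length \<open>k\<close>.\<close>

lemma rect_permanent_tridiag:
  "rect_permanent (tridiag \<alpha> \<beta> \<gamma>) {i..<i + k} {i..<i + k} = continuant \<beta> (\<alpha> * \<gamma>) k"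
proof (induction \<beta> "\<alpha> * \<gamma>" k arbitrary: i rule: continuant.induct)
  case 1
  then show ?case by simp
next
  case (2 \<beta>)
  have "{i..<i + Suc 0} = {i}" by auto
  then show ?case by (simp add: rect_permanent_row[of _ _ i] tridiag_def)
next
  case (3 \<beta> k)
  let ?T = "tridiag \<alpha> \<beta> \<gamma>" and ?I = "{i..<i + Suc (Suc k)}"
  have sets: "?I - {i} = {Suc i..<Suc i + Suc k}"
    "?I - {i} - {Suc i} = {Suc (Suc i)..<Suc (Suc i) + k}"
    "?I - {Suc i} - {i} = {Suc (Suc i)..<Suc (Suc i) + k}"
    by auto
  have "rect_permanent ?T ?I ?I
      = (\<Sum>c\<in>{i, Suc i}. ?T i c * rect_permanent ?T (?I - {i}) (?I - {c}))"
    by (intro rect_permanent_row_support) (auto simp: tridiag_def)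
  also have "\<dots> = \<beta> * rect_permanent ?T (?I - {i}) (?I - {i})
      + \<gamma> * rect_permanent ?T (?I - {i}) (?I - {Suc i})"
    by (simp add: tridiag_def)
  also have "rect_permanent ?T (?I - {i}) (?I - {Suc i})
      = (\<Sum>r\<in>{Suc i}. ?T r i * rect_permanent ?T (?I - {i} - {r}) (?I - {Suc i} - {i}))"
    by (intro rect_permanent_col_support) (auto simp: tridiag_def)
  also have "\<dots> = ?T (Suc i) i * rect_permanent ?T (?I - {i} - {Suc i}) (?I - {Suc i} - {i})"
    by simp
  also have "\<dots> = \<alpha> * continuant \<beta> (\<alpha> * \<gamma>) k"
    unfolding sets(2,3) 3(2) tridiag_simps ..
  also have "rect_permanent ?T (?I - {i}) (?I - {i}) = continuant \<beta> (\<alpha> * \<gamma>) (Suc k)"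
    using 3(1) by (simp only: sets)
  finally show ?case by simp
qed

text \<open>Shifting the columns by one makes the window lower triangular with
  \<open>\<gamma>\<close> on its diagonal.\<close>

lemma rect_permanent_tridiag_superdiagonal:
  "rect_permanent (tridiag \<alpha> \<beta> \<gamma>) {i..<i + k} {Suc i..<Suc i + k} = \<gamma> ^ k"
proof (induction k arbitrary: i)
  case 0
  then show ?case by simp
next
  case (Suc k)
  let ?T = "tridiag \<alpha> \<beta> \<gamma>" and ?R = "{i..<i + Suc k}" and ?C = "{Suc i..<Suc i + Suc k}"
  have sets: "?R - {i} = {Suc i..<Suc i + k}" "?C - {Suc i} = {Suc (Suc i)..<Suc (Suc i) + k}"
    by auto
  have "rect_permanent ?T ?R ?C
      = (\<Sum>c\<in>{Suc i}. ?T i c * rect_permanent ?T (?R - {i}) (?C - {c}))"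
    by (intro rect_permanent_row_support) (auto simp: tridiag_def)
  also have "\<dots> = ?T i (Suc i) * rect_permanent ?T (?R - {i}) (?C - {Suc i})"
    by simp
  finally show ?case
    by (simp only: sets Suc tridiag_simps power_Suc)
qed

lemma tridiag_transpose: "(\<lambda>i j. tridiag \<alpha> \<beta> \<gamma> j i) = tridiag \<gamma> \<beta> \<alpha>"
  by (auto simp: tridiag_def fun_eq_iff)

lemma rect_permanent_tridiag_subdiagonal:
  "rect_permanent (tridiag \<alpha> \<beta> \<gamma>) {Suc i..<Suc i + k} {i..<i + k} = \<alpha> ^ k"
  unfolding rect_permanent_transpose[of "tridiag \<alpha> \<beta> \<gamma>"] tridiag_transpose
  by (rule rect_permanent_tridiag_superdiagonal)

text \<open>The closed form of \<open>a(m)\<close> for \<open>m \<ge> 3\<close>. The terms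
  correspond to permutations that fix a chosen index, swap it with one of its two neighbours, or
  rotate the whole cycle in either direction.\<close>

definition cycle_permanent :: "real \<Rightarrow> real \<Rightarrow> real \<Rightarrow> nat \<Rightarrow> real" where
  "cycle_permanent \<alpha> \<beta> \<gamma> m =
     \<beta> * continuant \<beta> (\<alpha> * \<gamma>) (m - 1) + 2 * \<alpha> * \<gamma> * continuant \<beta> (\<alpha> * \<gamma>) (m - 2)
       + \<alpha> ^ m + \<gamma> ^ m"

text \<open>Row 0 is expanded first, then column 0 wherever it is still present. Both wrap-around
  corners are then gone, and every minor is a window of \<open>tridiag\<close>.\<close>

lemma rect_permanent_cyclic:
  assumes "m \<ge> 3"
    and diag: "\<And>i. i < m \<Longrightarrow> A i i = \<beta>"
    and succ: "\<And>i. i < m \<Longrightarrow> A i (Suc i mod m) = \<gamma>"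
    and pred: "\<And>i. i < m \<Longrightarrow> A (Suc i mod m) i = \<alpha>"
    and zero: "\<And>i j. i < m \<Longrightarrow> j < m \<Longrightarrow> j \<noteq> i \<Longrightarrow> j \<noteq> Suc i mod m \<Longrightarrow> i \<noteq> Suc j mod m \<Longrightarrow> A i j = 0"
  shows "rect_permanent A {..<m} {..<m} = cycle_permanent \<alpha> \<beta> \<gamma> m"
proof -
  obtain k where m: "m = Suc (Suc (Suc k))"
    using assms(1) le_Suc_ex[of 3 m] by auto
  let ?T = "tridiag \<alpha> \<beta> \<gamma>" and ?l = "Suc (Suc k)"
  have tri: "A i j = ?T i j" if "i < m" "j < m" "(i, j) \<noteq> (0, ?l)" "(i, j) \<noteq> (?l, 0)" for i j
  proof -
    have *: "Suc x mod m = (if x = ?l then 0 else Suc x)" if "x < m" for x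
      using that by (cases "Suc x = m") (use m in auto)
    show ?thesis
      using that diag[of i] succ[of i] pred[of j] zero[of i j] *[of i] *[of j]
      by (auto simp: tridiag_def split: if_splits)
  qed
  \<comment> \<open>Wrapping around exchanges the sides: the upper right corner carries the
    subdiagonal value \<open>\<alpha>\<close>, the lower left one \<open>\<gamma>\<close>.\<close>
  have corner: "A 0 ?l = \<alpha>" "A ?l 0 = \<gamma>"
    using pred[of ?l] succ[of ?l] by (auto simp: m)
  have tri_cong: "rect_permanent A R C = rect_permanent ?T R C"
    if "R \<subseteq> {..<m}" "C \<subseteq> {..<m}" "0 \<notin> R \<or> ?l \<notin> C" "?l \<notin> R \<or> 0 \<notin> C" for R C
    using that by (intro rect_permanent_cong tri) (auto intro!: gr0I)
  let ?I = "{..<m}"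
  have sets: "?I - {0} = {Suc 0..<Suc 0 + Suc (Suc k)}"
    "?I - {0} - {Suc 0} = {Suc (Suc 0)..<Suc (Suc 0) + Suc k}"
    "?I - {Suc 0} - {0} = {Suc (Suc 0)..<Suc (Suc 0) + Suc k}"
    "?I - {0} - {?l} = {Suc 0..<Suc 0 + Suc k}"
    "?I - {?l} - {0} = {Suc 0..<Suc 0 + Suc k}"
    by (auto simp: m)
  \<comment> \<open>Without row 0, column 0 has only the subdiagonal entry in row 1 and the corner
    entry in row \<open>?l\<close>; these rows differ because \<open>m \<ge> 3\<close>.\<close>
  have rows0: "rect_permanent A (?I - {0}) (?I - {c})
      = \<alpha> * rect_permanent A (?I - {0} - {Suc 0}) (?I - {c} - {0})
        + \<gamma> * rect_permanent A (?I - {0} - {?l}) (?I - {c} - {0})" if "c \<noteq> 0" for c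
  proof -
    have "rect_permanent A (?I - {0}) (?I - {c})
        = (\<Sum>r\<in>{Suc 0, ?l}. A r 0 * rect_permanent A (?I - {0} - {r}) (?I - {c} - {0}))"
      using that by (intro rect_permanent_col_support) (auto simp: m tri tridiag_def)
    then show ?thesis using tri[of "Suc 0" 0] corner by (simp add: m tridiag_def)
  qed
  have "rect_permanent A ?I ?I
      = (\<Sum>c\<in>{0, Suc 0, ?l}. A 0 c * rect_permanent A (?I - {0}) (?I - {c}))"
    by (intro rect_permanent_row_support) (auto simp: m tri tridiag_def)
  also have "\<dots> = \<beta> * rect_permanent A (?I - {0}) (?I - {0})
      + (\<gamma> * rect_permanent A (?I - {0}) (?I - {Suc 0}) + \<alpha> * rect_permanent A (?I - {0}) (?I - {?l}))"
    using diag[of 0] tri[of 0 "Suc 0"] corner by (simp add: m tridiag_def)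
  also have "rect_permanent A (?I - {0}) (?I - {0}) = continuant \<beta> (\<alpha> * \<gamma>) (Suc (Suc k))"
    unfolding sets(1) using rect_permanent_tridiag[of \<alpha> \<beta> \<gamma> "Suc 0" "Suc (Suc k)"]
    by (subst tri_cong) (auto simp: m simp del: continuant.simps)
  \<comment> \<open>Row 1 closes a swap of 0 and 1; the corner row \<open>?l\<close> closes the full
    rotation, which yields \<open>\<gamma> ^ m\<close> together with the factor from row 0.\<close>
  also have "rect_permanent A (?I - {0}) (?I - {Suc 0})
      = \<alpha> * continuant \<beta> (\<alpha> * \<gamma>) (Suc k) + \<gamma> * \<gamma> ^ Suc k"
  proof -
    have "rect_permanent A (?I - {0} - {Suc 0}) (?I - {Suc 0} - {0}) = continuant \<beta> (\<alpha> * \<gamma>) (Suc k)"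
      using rect_permanent_tridiag[of \<alpha> \<beta> \<gamma> "Suc (Suc 0)" "Suc k"]
      unfolding sets(2,3) by (subst tri_cong) (auto simp: m simp del: continuant.simps)
    moreover have "rect_permanent A (?I - {0} - {?l}) (?I - {Suc 0} - {0}) = \<gamma> ^ Suc k"
      using rect_permanent_tridiag_superdiagonal[of \<alpha> \<beta> \<gamma> "Suc 0" "Suc k"]
      unfolding sets(3,4) by (subst tri_cong) (auto simp: m simp del: continuant.simps)
    ultimately show ?thesis by (simp add: rows0)
  qed
  also have "rect_permanent A (?I - {0}) (?I - {?l})
      = \<alpha> * \<alpha> ^ Suc k + \<gamma> * continuant \<beta> (\<alpha> * \<gamma>) (Suc k)"
  proof -
    have "rect_permanent A (?I - {0} - {Suc 0}) (?I - {?l} - {0}) = \<alpha> ^ Suc k"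
      using rect_permanent_tridiag_subdiagonal[of \<alpha> \<beta> \<gamma> "Suc 0" "Suc k"]
      unfolding sets(2,5) by (subst tri_cong) (auto simp: m simp del: continuant.simps)
    moreover have "rect_permanent A (?I - {0} - {?l}) (?I - {?l} - {0}) = continuant \<beta> (\<alpha> * \<gamma>) (Suc k)"
      using rect_permanent_tridiag[of \<alpha> \<beta> \<gamma> "Suc 0" "Suc k"]
      unfolding sets(4,5) by (subst tri_cong) (auto simp: m simp del: continuant.simps)
    ultimately show ?thesis by (simp add: rows0)
  qed
  finally show ?thesis
    unfolding cycle_permanent_def m by (simp add: algebra_simps del: continuant.simps)
qed

section \<open>Initial values, recurrence and growth of the cycle permanents\<close>

lemma cycle_permanent_3:
  "cycle_permanent \<alpha> \<beta> \<gamma> 3 = \<alpha> ^ 3 + \<beta> ^ 3 + \<gamma> ^ 3 + 3 * \<alpha> * \<beta> * \<gamma>"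
  by (simp add: cycle_permanent_def numeral_eq_Suc algebra_simps)

lemma cycle_permanent_4:
  "cycle_permanent \<alpha> \<beta> \<gamma> 4
     = \<alpha> ^ 4 + \<beta> ^ 4 + \<gamma> ^ 4 + 4 * \<alpha> * \<beta> ^ 2 * \<gamma> + 2 * (\<alpha> * \<gamma>) ^ 2"
  by (simp add: cycle_permanent_def numeral_eq_Suc algebra_simps)

text \<open>The continuant terms satisfy the homogeneous recurrence. The corrections are what the
  powers leave over, for instance \<open>\<alpha> ^ m - \<beta> * \<alpha> ^ (m - 1) - \<alpha> *
  \<gamma> * \<alpha> ^ (m - 2)\<close>.\<close>

lemma cycle_permanent_rec:
  assumes "m \<ge> 5"
  shows "cycle_permanent \<alpha> \<beta> \<gamma> m
     = \<beta> * cycle_permanent \<alpha> \<beta> \<gamma> (m - 1) + \<alpha> * \<gamma> * cycle_permanent \<alpha> \<beta> \<gamma> (m - 2)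
       + \<alpha> ^ (m - 1) * (\<alpha> - \<beta> - \<gamma>) + \<gamma> ^ (m - 1) * (\<gamma> - \<beta> - \<alpha>)"
proof -
  obtain k where "m = 5 + k"
    using assms le_Suc_ex by blast
  then have "m = Suc (Suc (Suc (Suc (Suc k))))" by simp
  then show ?thesis by (simp add: cycle_permanent_def algebra_simps)
qed

lemma continuant_nonneg: "0 \<le> \<beta> \<Longrightarrow> 0 \<le> \<delta> \<Longrightarrow> 0 \<le> continuant \<beta> \<delta> k"
  by (induction \<beta> \<delta> k rule: continuant.induct) auto

lemma cycle_permanent_nonneg:
  assumes "0 \<le> \<alpha>" "0 \<le> \<beta>" "0 \<le> \<gamma>"
  shows "0 \<le> cycle_permanent \<alpha> \<beta> \<gamma> m"
  using assms by (simp add: cycle_permanent_def continuant_nonneg)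

text \<open>The condition \<open>t\<close> makes \<open>t ^ m\<close> a supersolution of the
  homogeneous recurrence; being of order two, it needs the two starting bounds at 3 and 4.\<close>

lemma cycle_permanent_le:
  fixes t :: real
  assumes "0 \<le> \<alpha>" "0 \<le> \<beta>" "0 \<le> \<gamma>" "\<alpha> \<le> \<beta> + \<gamma>" "\<gamma> \<le> \<alpha> + \<beta>"
    and "0 \<le> t" "cycle_permanent \<alpha> \<beta> \<gamma> 3 \<le> t ^ 3" "cycle_permanent \<alpha> \<beta> \<gamma> 4 \<le> t ^ 4"
    and t: "\<alpha> * \<gamma> + \<beta> * t \<le> t ^ 2"
    and "m \<ge> 3"
  shows "cycle_permanent \<alpha> \<beta> \<gamma> m \<le> t ^ m"
  using \<open>m \<ge> 3\<close>
proof (induction m rule: less_induct)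
  case (less m)
  consider "m = 3" | "m = 4" | "m \<ge> 5" using less.prems by linarith
  then show ?case
  proof cases
    case 3
    have "\<alpha> ^ (m - 1) * (\<alpha> - \<beta> - \<gamma>) \<le> 0" "\<gamma> ^ (m - 1) * (\<gamma> - \<beta> - \<alpha>) \<le> 0"
      using assms by (auto intro!: mult_nonneg_nonpos)
    then have "cycle_permanent \<alpha> \<beta> \<gamma> m
        \<le> \<beta> * cycle_permanent \<alpha> \<beta> \<gamma> (m - 1) + \<alpha> * \<gamma> * cycle_permanent \<alpha> \<beta> \<gamma> (m - 2)"
      using cycle_permanent_rec[OF 3, of \<alpha> \<beta> \<gamma>] by linarith
    also have "\<dots> \<le> \<beta> * t ^ (m - 1) + \<alpha> * \<gamma> * t ^ (m - 2)"
      using less.IH[of "m - 1"] less.IH[of "m - 2"] 3 assms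
      by (intro add_mono mult_left_mono) auto
    also have "\<dots> = (\<alpha> * \<gamma> + \<beta> * t) * t ^ (m - 2)"
    proof -
      have "m - 1 = Suc (m - 2)" using 3 by simp
      then show ?thesis by (simp only: power_Suc) (simp add: algebra_simps)
    qed
    also have "\<dots> \<le> t ^ 2 * t ^ (m - 2)"
      using t assms by (intro mult_right_mono) auto
    also have "\<dots> = t ^ m"
    proof -
      have "m = 2 + (m - 2)" using 3 by simp
      then show ?thesis by (metis power_add)
    qed
    finally show ?thesis .
  qed (use assms in auto)
qed

section \<open>Decomposition into cycles\<close>

text \<open>The support of the inverse permutation is tested as \<open>i = p j\<close>, without
  forming an inverse. On cycles of length at least 3 the three cases exclude one another.\<close>

definition hat_entry :: "real \<Rightarrow> real \<Rightarrow> real \<Rightarrow> ('a \<Rightarrow> 'a) \<Rightarrow> 'a \<Rightarrow> 'a \<Rightarrow> real" where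
  "hat_entry \<alpha> \<beta> \<gamma> p i j =
     (if j = i then \<beta> else if j = p i then \<gamma> else if i = p j then \<alpha> else 0)"

text \<open>Listing \<open>B\<close> as successive images of one element turns \<open>p\<close> into
  the successor modulo \<open>card B\<close>.\<close>

lemma rect_permanent_cyclic_on:
  assumes p: "cyclic_on p B" "card B \<ge> 3"
  shows "rect_permanent (hat_entry \<alpha> \<beta> \<gamma> p) B B = cycle_permanent \<alpha> \<beta> \<gamma> (card B)"
proof -
  obtain x where x: "x \<in> B" "B = orbit p x"
    using p(1) by (auto simp: cyclic_on_def)
  \<comment> \<open>The least positive period of \<open>x\<close>, hence the length of the
    cycle.\<close>
  define m where "m = funpow_dist1 p x x"
  define h where "h i = (p ^^ i) x" for i
  have self: "x \<in> orbit p x" using x by simp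
  have inj: "inj_on h {..<m}"
    using inj_on_funpow_dist1[OF self] by (simp add: h_def[abs_def] m_def lessThan_atLeast0)
  have B: "B = h ` {..<m}"
    using orbit_conv_funpow_dist1[OF self] x(2) by (simp add: h_def[abs_def] m_def lessThan_atLeast0)
  have card: "card B = m"
    using inj B by (simp add: card_image)
  have hm: "h m = h 0"
    using funpow_dist1_prop[OF self] by (simp add: h_def m_def)
  have step: "p (h i) = h (Suc i mod m)" if "i < m" for i
  proof -
    have "p (h i) = h (Suc i)" by (simp add: h_def)
    then show ?thesis using that hm by (cases "Suc i = m") auto
  qed
  have eq: "h i = h j \<longleftrightarrow> i = j" if "i < m" "j < m" for i j
    using inj that by (auto simp: inj_on_def)
  have m: "m \<ge> 3" using p(2) card by simp
  have lt: "Suc i mod m < m" for i using m by simp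
  have ne: "Suc i mod m \<noteq> i" "Suc (Suc i mod m) mod m \<noteq> i" if "i < m" for i
    using that m by (auto simp: mod_Suc)
  have "rect_permanent (hat_entry \<alpha> \<beta> \<gamma> p) B B
      = rect_permanent (\<lambda>i j. hat_entry \<alpha> \<beta> \<gamma> p (h i) (h j)) {..<m} {..<m}"
    unfolding B using inj by (intro rect_permanent_image) auto
  also have "\<dots> = cycle_permanent \<alpha> \<beta> \<gamma> m"
    using m ne ne[THEN not_sym] lt
    by (intro rect_permanent_cyclic) (simp_all add: hat_entry_def step eq)
  finally show ?thesis using card by simp
qed

text \<open>Each cycle is closed under \<open>p\<close>, so entries joining different cycles are
  zero and the matrix is block diagonal. The partition is exported because both the upper bound and
  the extremal case count its blocks.\<close>

lemma rect_permanent_hat_cycles: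
  assumes p: "p permutes S" "finite S" and orb: "\<And>i. i \<in> S \<Longrightarrow> 3 \<le> card (orbit p i)"
  obtains P where "finite P" "\<Union>P = S" "disjoint P" "\<And>B. B \<in> P \<Longrightarrow> cyclic_on p B \<and> finite B \<and> card B \<ge> 3"
    "rect_permanent (hat_entry \<alpha> \<beta> \<gamma> p) S S = (\<Prod>B\<in>P. cycle_permanent \<alpha> \<beta> \<gamma> (card B))"
proof -
  obtain P where P: "\<forall>B\<in>P. cyclic_on p B" "\<Union>P = S" "\<forall>B\<in>P. \<forall>B'\<in>P. B \<noteq> B' \<longrightarrow> B \<inter> B' = {}"
    using permutes_decompose[OF p] by auto
  have fin: "finite P" using P(2) p(2) by (auto intro: finite_UnionD)
  have finB: "finite B" if "B \<in> P" for B
    using P(1) that by (auto intro: finite_cyclic_on)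
  have card: "card B \<ge> 3" if B: "B \<in> P" for B
  proof -
    obtain x where "x \<in> B" "B = orbit p x" using P(1) B by (auto simp: cyclic_on_def)
    then show ?thesis using orb P(2) B by auto
  qed
  have "rect_permanent (hat_entry \<alpha> \<beta> \<gamma> p) (\<Union>P) (\<Union>P)
      = (\<Prod>B\<in>P. rect_permanent (hat_entry \<alpha> \<beta> \<gamma> p) B B)"
  proof (intro rect_permanent_block_diagonal)
    fix B B' i j
    assume "B \<in> P" "B' \<in> P" "B \<noteq> B'" and ij: "i \<in> B" "j \<in> B'"
    then have "B \<inter> B' = {}" "p i \<in> B" "p j \<in> B'"
      using P by (auto intro: cyclic_on_inI)
    then show "hat_entry \<alpha> \<beta> \<gamma> p i j = 0"
      using ij by (auto simp: hat_entry_def)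
  qed (use fin P(3) finB in \<open>auto simp: disjoint_def\<close>)
  also have "\<dots> = (\<Prod>B\<in>P. cycle_permanent \<alpha> \<beta> \<gamma> (card B))"
    using P(1) card by (intro prod.cong refl rect_permanent_cyclic_on) auto
  finally have "rect_permanent (hat_entry \<alpha> \<beta> \<gamma> p) S S
      = (\<Prod>B\<in>P. cycle_permanent \<alpha> \<beta> \<gamma> (card B))"
    by (simp add: P(2))
  then show thesis
    using that[of P] fin P card finB by (auto simp: disjoint_def)
qed

section \<open>Upper bound and extremal permutations\<close>

lemma permanent_hat:
  assumes p: "p permutes {0..<n}" and orb: "\<forall>i<n. 3 \<le> card (orbit p i)"
  shows "permanent (\<alpha> \<cdot>\<^sub>m perm_mat n (inv_into UNIV p) + \<beta> \<cdot>\<^sub>m 1\<^sub>m n + \<gamma> \<cdot>\<^sub>m perm_mat n p)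
    = rect_permanent (hat_entry \<alpha> \<beta> \<gamma> p) {0..<n} {0..<n}" (is "permanent ?X = _")
proof -
  have dim: "dim_row ?X = n" "dim_col ?X = n" by (simp_all add: perm_mat_def)
  \<comment> \<open>Cycles of length at least 3 keep the three supports disjoint, so the sum of
    matrices agrees with the case distinction in \<open>hat_entry\<close>.\<close>
  have ne: "p i \<noteq> i" "p (p i) \<noteq> i" if "i < n" for i
    using orb card_orbit_ge_3_iff[OF p that] that by auto
  have entry: "?X $$ (i, j) = hat_entry \<alpha> \<beta> \<gamma> p i j" if "i < n" "j < n" for i j
  proof -
    have "j = inv_into UNIV p i \<longleftrightarrow> i = p j" using permutes_inv_eq[OF p] by metis
    then show ?thesis
      using that ne[of i] ne[of j] dim by (auto simp: hat_entry_def perm_mat_def)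
  qed
  have "{q. q permutes {0..<n}} = {f. bij_betw f {0..<n} {0..<n} \<and> (\<forall>x. x \<notin> {0..<n} \<longrightarrow> f x = x)}"
    by (auto intro!: bij_imp_permutes permutes_imp_bij dest: permutes_not_in)
  then show ?thesis
    unfolding permanent_def dim rect_permanent_def
    by (auto intro!: sum.cong prod.cong entry simp: bij_betw_def)
qed

text \<open>The bound is applied cycle by cycle, nonnegativity allowing the inequalities to be
  multiplied; the exponents add up to \<open>n\<close> because the cycles partition the index
  set.\<close>

lemma permanent_hat_le:
  assumes p: "p permutes {0..<n}" "\<forall>i<n. 3 \<le> card (orbit p i)"
    and nonneg: "0 \<le> \<alpha>" "0 \<le> \<beta>" "0 \<le> \<gamma>"
    and le: "\<And>m. m \<ge> 3 \<Longrightarrow> cycle_permanent \<alpha> \<beta> \<gamma> m \<le> t ^ m"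
  shows "permanent (\<alpha> \<cdot>\<^sub>m perm_mat n (inv_into UNIV p) + \<beta> \<cdot>\<^sub>m 1\<^sub>m n + \<gamma> \<cdot>\<^sub>m perm_mat n p) \<le> t ^ n"
proof -
  obtain P where P: "finite P" "\<Union>P = {0..<n}" "disjoint P"
    "\<And>B. B \<in> P \<Longrightarrow> cyclic_on p B \<and> finite B \<and> card B \<ge> 3"
    "rect_permanent (hat_entry \<alpha> \<beta> \<gamma> p) {0..<n} {0..<n} = (\<Prod>B\<in>P. cycle_permanent \<alpha> \<beta> \<gamma> (card B))"
    using rect_permanent_hat_cycles[of p "{0..<n}" \<alpha> \<beta> \<gamma>] p by (metis atLeastLessThan_iff finite_atLeastLessThan)
  have "(\<Prod>B\<in>P. cycle_permanent \<alpha> \<beta> \<gamma> (card B)) \<le> (\<Prod>B\<in>P. t ^ card B)"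
    using P(4) by (intro prod_mono) (auto intro: cycle_permanent_nonneg nonneg le)
  also have "\<dots> = t ^ (\<Sum>B\<in>P. card B)"
    by (simp add: power_sum)
  also have "(\<Sum>B\<in>P. card B) = card (\<Union>P)"
    using P by (intro card_Union_disjoint[symmetric]) auto
  finally show ?thesis
    using permanent_hat[OF p] P by simp
qed

lemma permanent_hat_three_cycles:
  assumes p: "p permutes {0..<n}" "\<And>i. i < n \<Longrightarrow> card (orbit p i) = 3"
  shows "permanent (\<alpha> \<cdot>\<^sub>m perm_mat n (inv_into UNIV p) + \<beta> \<cdot>\<^sub>m 1\<^sub>m n + \<gamma> \<cdot>\<^sub>m perm_mat n p)
    = cycle_permanent \<alpha> \<beta> \<gamma> 3 ^ (n div 3)"
proof -
  have ge: "\<forall>i<n. 3 \<le> card (orbit p i)" using p(2) by simp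
  obtain P where P: "finite P" "\<Union>P = {0..<n}" "disjoint P"
    "\<And>B. B \<in> P \<Longrightarrow> cyclic_on p B \<and> finite B \<and> card B \<ge> 3"
    "rect_permanent (hat_entry \<alpha> \<beta> \<gamma> p) {0..<n} {0..<n} = (\<Prod>B\<in>P. cycle_permanent \<alpha> \<beta> \<gamma> (card B))"
    using rect_permanent_hat_cycles[of p "{0..<n}" \<alpha> \<beta> \<gamma>] p(1) ge by (metis atLeastLessThan_iff finite_atLeastLessThan)
  have card: "card B = 3" if B: "B \<in> P" for B
  proof -
    obtain x where "x \<in> B" "B = orbit p x" using P(4) B by (auto simp: cyclic_on_def)
    moreover have "x < n" using \<open>x \<in> B\<close> B P(2) by auto
    ultimately show ?thesis using p(2) by simp
  qed
  have "n = card (\<Union>P)" by (simp add: P(2))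
  also have "\<dots> = (\<Sum>B\<in>P. card B)" using P by (intro card_Union_disjoint) auto
  finally have "n = 3 * card P" using card by simp
  then show ?thesis
    using permanent_hat[OF p(1) ge] P(5) card by simp
qed

lemma three_cycles_exist:
  fixes n :: nat
  assumes "3 dvd n"
  obtains p where "p permutes {0..<n}" "\<And>i. i < n \<Longrightarrow> card (orbit p i) = 3"
proof -
  \<comment> \<open>Rotates each block of three consecutive indices \<open>3 * q\<close>,
    \<open>3 * q + 1\<close>, \<open>3 * q + 2\<close>.\<close>
  define p where "p i = (if i < n then if i mod 3 = 2 then i - 2 else Suc i else i)" for i
  have three: "p i < n \<and> p i \<noteq> i \<and> p (p i) \<noteq> i \<and> p (p (p i)) = i" if i: "i < n" for i
  proof -
    obtain k where n: "n = 3 * k" using assms by auto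
    obtain q r where ir: "i = 3 * q + r" "r < 3"
      using that mult_div_mod_eq[of 3 i] mod_less_divisor[of 3 i] by (metis zero_less_numeral)
    have "q < k" using i ir n by linarith
    have "r = 0 \<or> r = 1 \<or> r = 2" using ir by linarith
    then have "(i = 3 * q \<or> i = 3 * q + 1 \<or> i = 3 * q + 2) \<and> p (3 * q) = 3 * q + 1
      \<and> p (3 * q + 1) = 3 * q + 2 \<and> p (3 * q + 2) = 3 * q \<and> 3 * q + 2 < n"
      using ir \<open>q < k\<close> n by (auto simp: p_def mod_Suc)
    then show ?thesis by auto
  qed
  have off: "p i = i" if "i \<notin> {0..<n}" for i using that by (simp add: p_def)
  have "bij_betw p {0..<n} {0..<n}"
    \<comment> \<open>Since \<open>p\<close> has order 3 on the range, its square is its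
      inverse.\<close>
    using three by (intro bij_betwI[of _ _ _ "\<lambda>i. p (p i)"]) auto
  then have p: "p permutes {0..<n}" using off by (intro bij_imp_permutes) auto
  have "card (orbit p i) = 3" if i: "i < n" for i
  proof -
    have "(p ^^ 3) i = i" using three[OF i] by (simp add: numeral_3_eq_3)
    then have "orbit p i = (\<lambda>m. (p ^^ m) i) ` {..<3}"
      by (subst orbit_altdef_bounded) auto
    then have "card (orbit p i) \<le> 3"
      using card_image_le[of "{..<3::nat}" "\<lambda>m. (p ^^ m) i"] by simp
    moreover have "3 \<le> card (orbit p i)"
      using card_orbit_ge_3_iff[OF p i] three[OF i] by auto
    ultimately show ?thesis by simp
  qed
  then show thesis using that p by blast
qed

theorem theorem4:
  fixes \<alpha> \<beta> \<gamma> :: real and a :: "nat \<Rightarrow> real" and n :: nat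
  assumes "\<alpha> \<noteq> 0" and "\<beta> \<noteq> 0" and "\<gamma> \<noteq> 0"
    and "0 \<le> \<alpha>" and "\<alpha> \<le> \<beta> + \<gamma>"
    and "0 \<le> \<gamma>" and "\<gamma> \<le> \<alpha> + \<beta>"
    and "a 3 = \<alpha> ^ 3 + \<beta> ^ 3 + \<gamma> ^ 3 + 3 * \<alpha> * \<beta> * \<gamma>"
    and "a 4 = \<alpha> ^ 4 + \<beta> ^ 4 + \<gamma> ^ 4 + 4 * \<alpha> * \<beta> ^ 2 * \<gamma> + 2 * (\<alpha> * \<gamma>) ^ 2"
    and "\<And>m. m \<ge> 5 \<Longrightarrow>
           a m = \<beta> * a (m - 1) + \<alpha> * \<gamma> * a (m - 2)
                 + \<alpha> ^ (m - 1) * (\<alpha> - \<beta> - \<gamma>) + \<gamma> ^ (m - 1) * (\<gamma> - \<beta> - \<alpha>)"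
    and "a 4 ^ 3 \<le> a 3 ^ 4"
    and "\<alpha> * \<gamma> + \<beta> * a 3 powr (1 / 3) \<le> a 3 powr (2 / 3)"
    and "n > 0" and "3 dvd n"
  shows "M n \<alpha> \<beta> \<gamma> = a 3 ^ (n div 3)"
proof -
  let ?c = "cycle_permanent \<alpha> \<beta> \<gamma>"
  let ?X = "\<lambda>p. \<alpha> \<cdot>\<^sub>m perm_mat n (inv_into UNIV p) + \<beta> \<cdot>\<^sub>m 1\<^sub>m n + \<gamma> \<cdot>\<^sub>m perm_mat n p"
  \<comment> \<open>Adding the two triangle inequalities gives
    \<open>0 \<le> 2 * \<beta>\<close>.\<close>
  have nonneg: "0 \<le> \<alpha>" "0 \<le> \<beta>" "0 \<le> \<gamma>" using assms by linarith+
  have c3: "a 3 = ?c 3" and c4: "a 4 = ?c 4"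
    using assms by (simp_all add: cycle_permanent_3 cycle_permanent_4)
  define t where "t = a 3 powr (1 / 3)"
  \<comment> \<open>Positivity of \<open>a 3\<close> makes \<open>t\<close>, defined through
    \<open>powr\<close>, a genuine cube root.\<close>
  have "0 < \<alpha> ^ 3" using assms by simp
  then have pos: "a 3 > 0"
    unfolding assms(8) using nonneg by (intro add_pos_nonneg) auto
  have t0: "0 \<le> t" by (simp add: t_def)
  have t3: "t ^ 3 = a 3" and t2: "t ^ 2 = a 3 powr (2 / 3)"
    using pos by (simp_all add: t_def powr_powr flip: powr_numeral)
  have "a 4 ^ 3 \<le> (t ^ 4) ^ 3"
  proof -
    have "(t ^ 4) ^ 3 = (t ^ 3) ^ 4" by simp
    then show ?thesis using assms(11) by (simp only: t3)
  qed
  then have "a 4 \<le> t ^ 4"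
    \<comment> \<open>Cube roots are taken on both sides; the rule speaks of the power
      \<open>Suc n\<close>, hence the instance 2.\<close>
    using power_le_imp_le_base[of "a 4" 2 "t ^ 4"] t0 by simp
  then have le: "?c m \<le> t ^ m" if "m \<ge> 3" for m
    using cycle_permanent_le[OF nonneg assms(5,7) t0, of m] that assms(12) t2 t3 c3 c4
    by (simp add: t_def)
  have tn: "t ^ n = a 3 ^ (n div 3)"
    unfolding t3[symmetric] power_mult[symmetric] using \<open>3 dvd n\<close> by simp
  obtain p where p: "p permutes {0..<n}" "\<And>i. i < n \<Longrightarrow> card (orbit p i) = 3"
    using three_cycles_exist[OF \<open>3 dvd n\<close>] by blast
  have "a 3 ^ (n div 3) = permanent (?X p)"
    using permanent_hat_three_cycles[OF p] c3 by simp
  moreover have "?X p \<in> Lambda_hat n \<alpha> \<beta> \<gamma>"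
    unfolding Lambda_hat_eq using p by auto
  ultimately have "a 3 ^ (n div 3) \<in> permanent ` Lambda_hat n \<alpha> \<beta> \<gamma>" by blast
  moreover have "y \<le> a 3 ^ (n div 3)" if "y \<in> permanent ` Lambda_hat n \<alpha> \<beta> \<gamma>" for y
    using that permanent_hat_le[OF _ _ nonneg le] unfolding Lambda_hat_eq tn[symmetric] by auto
  ultimately show ?thesis
    unfolding M_def by (intro Max_eqI finite_imageI finite_Lambda_hat) auto
qed

end
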